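(* Let $(L,\vee,\wedge,0,1)$ be a bounded lattice satisfying the Ascending Chain Condition, let $x,y,a\in L$ and $A,B\subseteq L$. Then the following hold: (i) $a'\wedge b'=0$ for all $a'\in A$ and all $b'\in A^0$; especially, $x\wedge x^0=0$. (ii) If $a'\wedge b'=0$ for all $a'\in A$ and all $b'\in B$, then $A\leq_1 B^0$; especially, $x\wedge y=0$ implies $x\leq_1 y^0$. (iii) $A\leq_1 A^{00}$; especially, $x\leq_1 x^{00}$. (iv) $A\leq_1 B$ implies $B^0\leq_1 A^0$; especially, $x\leq y$ implies $y^0\leq_1 x^0$. (v) $A\leq_1 B^0$ if and only if $B\leq_1 A^0$; especially, $x\leq_1 y^0$ if and only if $y\leq_1 x^0$. (vi) $a=_1 B^0$ implies $a=B^0$. (vii) $A^0=_1 B^0$ implies $A^0=B^0$. (viii) $A^{000}=A^0$; especially, $x^{000}=x^0$. (ix) $(A\vee B)^0\leq_1 A^0\wedge B^0$; especially, $(x\vee y)^0\leq_1 x^0\wedge y^0$. (x) $(A\wedge B)^{00}=_1 A^{00}\wedge B^{00}$; especially, $(x\wedge y)^{00}=_1 x^{00}\wedge y^{00}$. (xi) $A^{00}\vee B^{00}\leq_1 (A^0\wedge B^0)^0$ implies $(A^{00}\vee B^{00})^0=_1 A^0\wedge B^0$; especially, $x^{00}\vee y^{00}\leq_1 (x^0\wedge y^0)^0$ implies $(x^{00}\vee y^{00})^0=_1 x^0\wedge y^0$.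
   Context: Singletons are identified with their unique element (so $a$ stands for $\{a\}$ wherever a subset is expected, and e.g. $x\wedge x^0=0$ means $\{x\}\wedge x^0=\{0\}$). For subsets $A,B$ of $L$: $A\vee B:=\{x\vee y\mid x\in A, y\in B\}$, $A\wedge B:=\{x\wedge y\mid x\in A, y\in B\}$, and $A^0$ is the set of all maximal elements of $\{x\in L\mid x\wedge y=0\text{ for all }y\in A\}$. For $a\in L$, $a^0:=\{a\}^0$. One writes $A^{00}:=(A^0)^0$ and $A^{000}:=((A^0)^0)^0$. $A\leq_1 B$ means that for every $x\in A$ there exists some $y\in B$ with $x\leq y$; $A=_1 B$ means that both $A\leq_1 B$ and $B\leq_1 A$.
   Formalization: In the set version of (ix), A and B are assumed nonempty; as stated it fails for A empty and B={1} when 0≠1, since then (A∨B)^0={1} but A^0∧B^0={0}. *)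

theory Defs
  imports Main
begin

unbundle lattice_syntax

text \<open>The carrier \<open>L\<close> is a type of class \<^class>\<open>bounded_lattice\<close>, with \<open>\<bottom>\<close> and \<open>\<top>\<close> for \<open>0\<close> and
  \<open>1\<close>. Where a single element stands for a subset, the singleton is written out.\<close>

definition ascending_chain_condition :: "'a::order itself \<Rightarrow> bool" where
  "ascending_chain_condition _ \<longleftrightarrow> (\<nexists>f :: nat \<Rightarrow> 'a. \<forall>n. f n < f (Suc n))"

definition set_join :: "'a::lattice set \<Rightarrow> 'a set \<Rightarrow> 'a set" (infixl "\<or>\<^sub>s" 65) where
  "A \<or>\<^sub>s B = {x \<squnion> y | x y. x \<in> A \<and> y \<in> B}"

definition set_meet :: "'a::lattice set \<Rightarrow> 'a set \<Rightarrow> 'a set" (infixl "\<and>\<^sub>s" 70) where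
  "A \<and>\<^sub>s B = {x \<sqinter> y | x y. x \<in> A \<and> y \<in> B}"

definition maximal_elements :: "'a::order set \<Rightarrow> 'a set" where
  "maximal_elements S = {x \<in> S. \<not> (\<exists>y \<in> S. x < y)}"

definition set_pcompl :: "'a::bounded_lattice set \<Rightarrow> 'a set" ("(_\<^sup>0)" [1000] 1000) where
  "A\<^sup>0 = maximal_elements {x. \<forall>y \<in> A. x \<sqinter> y = \<bottom>}"

definition le1 :: "'a::order set \<Rightarrow> 'a set \<Rightarrow> bool" (infix "\<le>\<^sub>1" 50) where
  "A \<le>\<^sub>1 B \<longleftrightarrow> (\<forall>x \<in> A. \<exists>y \<in> B. x \<le> y)"

definition eq1 :: "'a::order set \<Rightarrow> 'a set \<Rightarrow> bool" (infix "=\<^sub>1" 50) where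
  "A =\<^sub>1 B \<longleftrightarrow> A \<le>\<^sub>1 B \<and> B \<le>\<^sub>1 A"

end

theory Submission
  imports Defs
begin

text \<open>Under the Ascending Chain Condition every element of the annihilator of \<open>B\<close> lies below an element of
  \<open>B\<^sup>0\<close>. Hence \<open>A \<le>\<^sub>1 B\<^sup>0\<close> holds iff \<open>A\<close> and \<open>B\<close> meet elementwise in \<open>\<bottom>\<close>; this
  relation is symmetric in \<open>A\<close> and \<open>B\<close>, so \<open>A \<mapsto> A\<^sup>0\<close> is an antitone Galois connection for
  \<open>\<le>\<^sub>1\<close>. Equalities follow from \<open>=\<^sub>1\<close> because the sets \<open>A\<^sup>0\<close> are antichains.\<close>

text \<open>The Ascending Chain Condition makes the reversed order well-founded. A maximal element
  of the part of \<open>S\<close> above \<open>z\<close> is maximal in all of \<open>S\<close>,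
  since whatever exceeds it is again above \<open>z\<close>.\<close>

lemma ex_maximal_element_ge:
  fixes S :: "'a::order set"
  assumes acc: "ascending_chain_condition TYPE('a)" and "z \<in> S"
  shows "\<exists>m \<in> maximal_elements S. z \<le> m"
proof -
  have "wf {(v, u :: 'a). u < v}"
    using acc by (simp add: wf_iff_no_infinite_down_chain ascending_chain_condition_def)
  moreover have "z \<in> {u \<in> S. z \<le> u}"
    using \<open>z \<in> S\<close> by simp
  ultimately obtain m where "m \<in> {u \<in> S. z \<le> u}"
    and "\<And>v. (v, m) \<in> {(v, u). u < v} \<Longrightarrow> v \<notin> {u \<in> S. z \<le> u}"
    by (rule wfE_min) blast
  then show ?thesis
    by (fastforce simp: maximal_elements_def)
qed

lemma le1_trans: "A \<le>\<^sub>1 B \<Longrightarrow> B \<le>\<^sub>1 C \<Longrightarrow> A \<le>\<^sub>1 C"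
  unfolding le1_def by (meson order_trans)

text \<open>In the preorder \<open>\<le>\<^sub>1\<close> the elementwise meet is a greatest lower
  bound; \<open>u \<sqinter> v\<close> serves as the bound for \<open>c\<close>.\<close>

lemma le1_set_meet_iff:
  fixes A B C :: "'a::lattice set"
  shows "C \<le>\<^sub>1 A \<and>\<^sub>s B \<longleftrightarrow> C \<le>\<^sub>1 A \<and> C \<le>\<^sub>1 B"
proof
  assume "C \<le>\<^sub>1 A \<and>\<^sub>s B"
  then show "C \<le>\<^sub>1 A \<and> C \<le>\<^sub>1 B"
    unfolding le1_def set_meet_def by fastforce
next
  assume *: "C \<le>\<^sub>1 A \<and> C \<le>\<^sub>1 B"
  show "C \<le>\<^sub>1 A \<and>\<^sub>s B"
    unfolding le1_def
  proof
    fix c assume "c \<in> C"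
    with * obtain u v where "u \<in> A" "v \<in> B" "c \<le> u" "c \<le> v"
      unfolding le1_def by blast
    then show "\<exists>m \<in> A \<and>\<^sub>s B. c \<le> m"
      unfolding set_meet_def by (blast intro: le_infI)
  qed
qed

lemma inf_pcompl_eq_bot: "a \<in> A \<Longrightarrow> b \<in> A\<^sup>0 \<Longrightarrow> a \<sqinter> b = \<bottom>"
  by (auto simp: set_pcompl_def maximal_elements_def inf_commute)

lemma inf_eq_bot_mono:
  fixes u v :: "'a::bounded_lattice"
  shows "u \<sqinter> v = \<bottom> \<Longrightarrow> u' \<le> u \<Longrightarrow> v' \<le> v \<Longrightarrow> u' \<sqinter> v' = \<bottom>"
  by (metis bot.extremum_uniqueI inf_mono)

lemma pcompl_eq_if_eq1:
  assumes "A\<^sup>0 =\<^sub>1 B\<^sup>0"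
  shows "A\<^sup>0 = B\<^sup>0"
proof -
  have "C\<^sup>0 \<subseteq> D\<^sup>0" if "C\<^sup>0 \<le>\<^sub>1 D\<^sup>0" "D\<^sup>0 \<le>\<^sub>1 C\<^sup>0" for C D :: "'a set"
  proof
    fix u assume u: "u \<in> C\<^sup>0"
    with that obtain v w where "v \<in> D\<^sup>0" "u \<le> v" "w \<in> C\<^sup>0" "v \<le> w"
      unfolding le1_def by meson
    \<comment> \<open>\<open>u\<close> is maximal in the annihilator of \<open>C\<close>, which also
      contains \<open>w\<close>; so the chain \<open>u \<le> v \<le> w\<close> collapses and
      \<open>u = v\<close>.\<close>
    moreover from this u have "\<not> u < w"
      by (auto simp: set_pcompl_def maximal_elements_def)
    ultimately show "u \<in> D\<^sup>0"
      by (metis order.not_eq_order_implies_strict order_antisym order_trans)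
  qed
  with assms show ?thesis
    unfolding eq1_def by blast
qed

text \<open>As \<open>{a}\<close> is not known to have the form \<open>C\<^sup>0\<close>, maximality
  is available on one side only: \<open>a\<close> is squeezed onto some \<open>b\<close> in
  \<open>B\<^sup>0\<close>, and each member of \<open>B\<^sup>0\<close> lies below \<open>b\<close>,
  hence equals it.\<close>

lemma singleton_eq_pcompl_if_eq1:
  assumes "{a} =\<^sub>1 B\<^sup>0"
  shows "{a} = B\<^sup>0"
proof -
  from assms obtain b where b: "b \<in> B\<^sup>0" "a \<le> b" and ub: "\<forall>c \<in> B\<^sup>0. c \<le> a"
    by (auto simp: eq1_def le1_def)
  then have "a = b"
    by (simp add: order_antisym)
  moreover have "c = b" if "c \<in> B\<^sup>0" for c
    using that ub b by (auto simp: set_pcompl_def maximal_elements_def order.order_iff_strict)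
  ultimately show ?thesis
    using b by blast
qed

context
  assumes acc: "ascending_chain_condition TYPE('a::bounded_lattice)"
begin

lemma le1_pcompl_iff:
  fixes A B :: "'a set"
  shows "A \<le>\<^sub>1 B\<^sup>0 \<longleftrightarrow> (\<forall>a \<in> A. \<forall>b \<in> B. a \<sqinter> b = \<bottom>)"
proof
  assume "A \<le>\<^sub>1 B\<^sup>0"
  then show "\<forall>a \<in> A. \<forall>b \<in> B. a \<sqinter> b = \<bottom>"
    unfolding le1_def by (metis inf_commute inf_eq_bot_mono inf_pcompl_eq_bot order_refl)
next
  assume "\<forall>a \<in> A. \<forall>b \<in> B. a \<sqinter> b = \<bottom>"
  then show "A \<le>\<^sub>1 B\<^sup>0"
    using ex_maximal_element_ge[OF acc] by (simp add: le1_def set_pcompl_def)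
qed

lemma le1_pcompl_commute:
  fixes A B :: "'a set"
  shows "A \<le>\<^sub>1 B\<^sup>0 \<longleftrightarrow> B \<le>\<^sub>1 A\<^sup>0"
  unfolding le1_pcompl_iff by (metis inf_commute)

lemma le1_pcompl_pcompl:
  fixes A :: "'a set"
  shows "A \<le>\<^sub>1 A\<^sup>0\<^sup>0"
  by (simp add: le1_pcompl_iff inf_pcompl_eq_bot)

text \<open>From \<open>A \<le>\<^sub>1 B \<le>\<^sub>1 B\<^sup>0\<^sup>0\<close>, exchange the two
  sides of \<open>A \<le>\<^sub>1 (B\<^sup>0)\<^sup>0\<close>.\<close>

lemma pcompl_antimono:
  fixes A B :: "'a set"
  shows "A \<le>\<^sub>1 B \<Longrightarrow> B\<^sup>0 \<le>\<^sub>1 A\<^sup>0"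
  using le1_pcompl_commute le1_pcompl_pcompl le1_trans by blast

text \<open>One half is \<open>le1_pcompl_pcompl\<close> at \<open>A\<^sup>0\<close>, the other its
  instance at \<open>A\<close> reversed by antitonicity.\<close>

lemma pcompl_pcompl_pcompl:
  fixes A :: "'a set"
  shows "A\<^sup>0\<^sup>0\<^sup>0 = A\<^sup>0"
  by (rule pcompl_eq_if_eq1) (simp add: eq1_def pcompl_antimono le1_pcompl_pcompl)

text \<open>\<open>w\<close> lies below a member of \<open>A\<^sup>0\<close>, which meets every
  \<open>u\<close> in \<open>A\<^sup>0\<^sup>0\<close> in \<open>\<bottom>\<close>. Annihilation
  thus passes from \<open>A\<close> to \<open>A\<^sup>0\<^sup>0\<close>.\<close>

lemma inf_pcompl_pcompl_eq_bot:
  fixes A :: "'a set"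
  assumes "\<forall>a \<in> A. w \<sqinter> a = \<bottom>" and "u \<in> A\<^sup>0\<^sup>0"
  shows "w \<sqinter> u = \<bottom>"
proof -
  have "{w} \<le>\<^sub>1 A\<^sup>0"
    using assms(1) by (simp add: le1_pcompl_iff)
  then show ?thesis
    using assms(2) by (auto simp: le1_def intro: inf_eq_bot_mono[OF inf_pcompl_eq_bot])
qed

text \<open>\<open>\<bottom>\<close> annihilates everything, so some member of
  \<open>A\<^sup>0\<close> lies above it. This is why \<open>{x} \<and>\<^sub>s {x}\<^sup>0\<close>
  is \<open>{\<bottom>}\<close> and not \<open>{}\<close>.\<close>

lemma pcompl_nonempty:
  fixes A :: "'a set"
  shows "A\<^sup>0 \<noteq> {}"
proof -
  have "{\<bottom>} \<le>\<^sub>1 A\<^sup>0"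
    by (simp add: le1_pcompl_iff)
  then show ?thesis
    by (auto simp: le1_def)
qed

text \<open>An element of the other set is needed to place a member of \<open>A\<close> or
  \<open>B\<close> below a join. For \<open>B = {}\<close> the left side is \<open>{\<top>}\<close>
  and the right side is \<open>A\<^sup>0\<close>, so the claim fails unless \<open>A\<close> is
  contained in \<open>{\<bottom>}\<close>.\<close>

lemma pcompl_set_join_le1:
  fixes A B :: "'a set"
  assumes "A \<noteq> {}" and "B \<noteq> {}"
  shows "(A \<or>\<^sub>s B)\<^sup>0 \<le>\<^sub>1 A\<^sup>0 \<and>\<^sub>s B\<^sup>0"
proof -
  have "A \<le>\<^sub>1 A \<or>\<^sub>s B" and "B \<le>\<^sub>1 A \<or>\<^sub>s B"
    using assms unfolding le1_def set_join_def by (blast intro: sup_ge1 sup_ge2)+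
  then show ?thesis
    by (simp add: le1_set_meet_iff pcompl_antimono)
qed

lemma pcompl_pcompl_set_meet:
  fixes A B :: "'a set"
  shows "(A \<and>\<^sub>s B)\<^sup>0\<^sup>0 =\<^sub>1 A\<^sup>0\<^sup>0 \<and>\<^sub>s B\<^sup>0\<^sup>0"
  unfolding eq1_def
proof
  have "A \<and>\<^sub>s B \<le>\<^sub>1 A" and "A \<and>\<^sub>s B \<le>\<^sub>1 B"
    unfolding le1_def set_meet_def by (blast intro: inf_le1 inf_le2)+
  then show "(A \<and>\<^sub>s B)\<^sup>0\<^sup>0 \<le>\<^sub>1 A\<^sup>0\<^sup>0 \<and>\<^sub>s B\<^sup>0\<^sup>0"
    by (simp add: le1_set_meet_iff pcompl_antimono)
next
  \<comment> \<open>Members of \<open>A\<close> and \<open>B\<close> are traded for \<open>u\<close>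
    and \<open>v\<close> one at a time: \<open>w \<sqinter> a\<close> annihilates \<open>B\<close>,
    hence \<open>v\<close>; then \<open>w \<sqinter> v\<close> annihilates \<open>A\<close>, hence
    \<open>u\<close>.\<close>
  have "(u \<sqinter> v) \<sqinter> w = \<bottom>" if u: "u \<in> A\<^sup>0\<^sup>0" and v: "v \<in> B\<^sup>0\<^sup>0" and w: "w \<in> (A \<and>\<^sub>s B)\<^sup>0" for u v w
  proof -
    have "(w \<sqinter> a) \<sqinter> b = \<bottom>" if "a \<in> A" "b \<in> B" for a b
    proof -
      have "a \<sqinter> b \<in> A \<and>\<^sub>s B"
        using that by (auto simp: set_meet_def)
      from inf_pcompl_eq_bot[OF this w] show ?thesis
        by (simp add: inf_commute inf_left_commute)
    qed
    then have "(w \<sqinter> a) \<sqinter> v = \<bottom>" if "a \<in> A" for a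
      using that v inf_pcompl_pcompl_eq_bot by blast
    then have "\<forall>a \<in> A. (w \<sqinter> v) \<sqinter> a = \<bottom>"
      by (simp add: inf_assoc inf_commute inf_left_commute)
    from inf_pcompl_pcompl_eq_bot[OF this u] show ?thesis
      by (simp add: inf_commute inf_left_commute)
  qed
  then show "A\<^sup>0\<^sup>0 \<and>\<^sub>s B\<^sup>0\<^sup>0 \<le>\<^sub>1 (A \<and>\<^sub>s B)\<^sup>0\<^sup>0"
    by (auto simp: le1_pcompl_iff set_meet_def)
qed

text \<open>Exchanging sides in the assumption gives one half. The other is
  \<open>pcompl_set_join_le1\<close> at \<open>A\<^sup>0\<^sup>0\<close> and
  \<open>B\<^sup>0\<^sup>0\<close>, with triple complements collapsed.\<close>

lemma pcompl_set_join_pcompl_pcompl: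
  fixes A B :: "'a set"
  assumes "A\<^sup>0\<^sup>0 \<or>\<^sub>s B\<^sup>0\<^sup>0 \<le>\<^sub>1 (A\<^sup>0 \<and>\<^sub>s B\<^sup>0)\<^sup>0"
  shows "(A\<^sup>0\<^sup>0 \<or>\<^sub>s B\<^sup>0\<^sup>0)\<^sup>0 =\<^sub>1 A\<^sup>0 \<and>\<^sub>s B\<^sup>0"
  using assms pcompl_set_join_le1[of "A\<^sup>0\<^sup>0" "B\<^sup>0\<^sup>0"]
  by (simp add: eq1_def pcompl_nonempty pcompl_pcompl_pcompl le1_pcompl_commute)

end

theorem theorem2p2:
  fixes x y a :: "'a::bounded_lattice" and A B :: "'a set"
  assumes "ascending_chain_condition TYPE('a)"
  shows
    "((\<forall>a' \<in> A. \<forall>b' \<in> A\<^sup>0. a' \<sqinter> b' = \<bottom>) \<and> {x} \<and>\<^sub>s {x}\<^sup>0 = {\<bottom>}) \<and>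
     (((\<forall>a' \<in> A. \<forall>b' \<in> B. a' \<sqinter> b' = \<bottom>) \<longrightarrow> A \<le>\<^sub>1 B\<^sup>0) \<and>
       (x \<sqinter> y = \<bottom> \<longrightarrow> {x} \<le>\<^sub>1 {y}\<^sup>0)) \<and>
     (A \<le>\<^sub>1 A\<^sup>0\<^sup>0 \<and> {x} \<le>\<^sub>1 {x}\<^sup>0\<^sup>0) \<and>
     ((A \<le>\<^sub>1 B \<longrightarrow> B\<^sup>0 \<le>\<^sub>1 A\<^sup>0) \<and> (x \<le> y \<longrightarrow> {y}\<^sup>0 \<le>\<^sub>1 {x}\<^sup>0)) \<and>
     ((A \<le>\<^sub>1 B\<^sup>0 \<longleftrightarrow> B \<le>\<^sub>1 A\<^sup>0) \<and> ({x} \<le>\<^sub>1 {y}\<^sup>0 \<longleftrightarrow> {y} \<le>\<^sub>1 {x}\<^sup>0)) \<and>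
     ({a} =\<^sub>1 B\<^sup>0 \<longrightarrow> {a} = B\<^sup>0) \<and>
     (A\<^sup>0 =\<^sub>1 B\<^sup>0 \<longrightarrow> A\<^sup>0 = B\<^sup>0) \<and>
     (A\<^sup>0\<^sup>0\<^sup>0 = A\<^sup>0 \<and> {x}\<^sup>0\<^sup>0\<^sup>0 = {x}\<^sup>0) \<and>
     ((A \<noteq> {} \<and> B \<noteq> {} \<longrightarrow> (A \<or>\<^sub>s B)\<^sup>0 \<le>\<^sub>1 A\<^sup>0 \<and>\<^sub>s B\<^sup>0) \<and>
       {x \<squnion> y}\<^sup>0 \<le>\<^sub>1 {x}\<^sup>0 \<and>\<^sub>s {y}\<^sup>0) \<and>
     ((A \<and>\<^sub>s B)\<^sup>0\<^sup>0 =\<^sub>1 A\<^sup>0\<^sup>0 \<and>\<^sub>s B\<^sup>0\<^sup>0 \<and>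
       {x \<sqinter> y}\<^sup>0\<^sup>0 =\<^sub>1 {x}\<^sup>0\<^sup>0 \<and>\<^sub>s {y}\<^sup>0\<^sup>0) \<and>
     ((A\<^sup>0\<^sup>0 \<or>\<^sub>s B\<^sup>0\<^sup>0 \<le>\<^sub>1 (A\<^sup>0 \<and>\<^sub>s B\<^sup>0)\<^sup>0 \<longrightarrow>
       (A\<^sup>0\<^sup>0 \<or>\<^sub>s B\<^sup>0\<^sup>0)\<^sup>0 =\<^sub>1 A\<^sup>0 \<and>\<^sub>s B\<^sup>0) \<and>
       ({x}\<^sup>0\<^sup>0 \<or>\<^sub>s {y}\<^sup>0\<^sup>0 \<le>\<^sub>1 ({x}\<^sup>0 \<and>\<^sub>s {y}\<^sup>0)\<^sup>0 \<longrightarrow>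
       ({x}\<^sup>0\<^sup>0 \<or>\<^sub>s {y}\<^sup>0\<^sup>0)\<^sup>0 =\<^sub>1 {x}\<^sup>0 \<and>\<^sub>s {y}\<^sup>0))"
proof -
  note acc = assms
  \<comment> \<open>These rewrite the clauses about elements into instances of the clauses about
    sets.\<close>
  have join: "{x \<squnion> y} = {x} \<or>\<^sub>s {y}" and meet: "{x \<sqinter> y} = {x} \<and>\<^sub>s {y}"
    by (auto simp: set_join_def set_meet_def)
  have "{x} \<and>\<^sub>s {x}\<^sup>0 = (\<lambda>z. x \<sqinter> z) ` {x}\<^sup>0"
    by (auto simp: set_meet_def)
  also have "\<dots> = (\<lambda>_. \<bottom>) ` {x}\<^sup>0"
    by (rule image_cong) (simp_all add: inf_pcompl_eq_bot[of _ "{x}"])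
  also have "\<dots> = {\<bottom>}"
    by (simp add: image_constant_conv pcompl_nonempty[OF acc])
  finally have "{x} \<and>\<^sub>s {x}\<^sup>0 = {\<bottom>}" .
  moreover have "x \<le> y \<longrightarrow> {y}\<^sup>0 \<le>\<^sub>1 {x}\<^sup>0"
    by (simp add: pcompl_antimono[OF acc] le1_def[of "{x}"])
  moreover have "x \<sqinter> y = \<bottom> \<longrightarrow> {x} \<le>\<^sub>1 {y}\<^sup>0"
    by (simp add: le1_pcompl_iff[OF acc])
  moreover have "{x \<squnion> y}\<^sup>0 \<le>\<^sub>1 {x}\<^sup>0 \<and>\<^sub>s {y}\<^sup>0"
    unfolding join by (simp add: pcompl_set_join_le1[OF acc])
  moreover have "{x \<sqinter> y}\<^sup>0\<^sup>0 =\<^sub>1 {x}\<^sup>0\<^sup>0 \<and>\<^sub>s {y}\<^sup>0\<^sup>0"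
    unfolding meet by (rule pcompl_pcompl_set_meet[OF acc])
  moreover have "(\<forall>a' \<in> A. \<forall>b' \<in> B. a' \<sqinter> b' = \<bottom>) \<longrightarrow> A \<le>\<^sub>1 B\<^sup>0"
    by (simp add: le1_pcompl_iff[OF acc])
  moreover have "\<forall>a' \<in> A. \<forall>b' \<in> A\<^sup>0. a' \<sqinter> b' = \<bottom>"
    by (simp add: inf_pcompl_eq_bot)
  \<comment> \<open>The facts collected above close by assumption; every other clause is a general
    lemma, at \<open>A\<close> and \<open>B\<close> or at singletons.\<close>
  ultimately show ?thesis
    apply (intro conjI)
    apply (assumption | rule le1_pcompl_commute[OF acc] le1_pcompl_pcompl[OF acc]
        pcompl_pcompl_pcompl[OF acc] pcompl_pcompl_set_meet[OF acc]
      | rule impI, erule pcompl_antimono[OF acc] pcompl_set_join_pcompl_pcompl[OF acc]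
          singleton_eq_pcompl_if_eq1 pcompl_eq_if_eq1
      | rule impI, erule conjE, erule (1) pcompl_set_join_le1[OF acc])+
    done
qed

end
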